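(* For all integers $l\geq 2$ and $N>0$ there exists an odd $l$-meager hypergraph with more than $N$ vertices.
   Context: A hypergraph is a pair $H=(U,T)$ where $U$ is a finite nonempty set of vertices and $T$ is a collection of 3-element subsets of $U$, called hyperedges. For a nonempty $X\subseteq U$, $\|X\|$ denotes its cardinality and its weight $[X]$ is the number of hyperedges $h\in T$ with $h\subseteq X$. A vertex set $X$ is dense if $\|X\|\leq 2[X]$. $H$ is $l$-meager if it has no dense vertex sets of cardinality $\leq 2l$. $H$ is odd if for every nonempty vertex set $X$ there is a hyperedge $h$ with $\|h\cap X\|$ odd. *)

theory Defs
  imports Main
begin

definition hypergraph :: "'a set \<Rightarrow> 'a set set \<Rightarrow> bool" where
  "hypergraph U T \<longleftrightarrow> finite U \<and> U \<noteq> {} \<and> (\<forall>h\<in>T. h \<subseteq> U \<and> card h = 3)"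

definition weight :: "'a set set \<Rightarrow> 'a set \<Rightarrow> nat" where
  "weight T X = card {h \<in> T. h \<subseteq> X}"

text \<open>Weight and density are notions for nonempty vertex sets only; without \<open>X \<noteq> {}\<close>
  the empty set would be dense and no hypergraph would be meager.\<close>

definition dense_set :: "'a set \<Rightarrow> 'a set set \<Rightarrow> 'a set \<Rightarrow> bool" where
  "dense_set U T X \<longleftrightarrow> X \<subseteq> U \<and> X \<noteq> {} \<and> card X \<le> 2 * weight T X"

definition meager :: "nat \<Rightarrow> 'a set \<Rightarrow> 'a set set \<Rightarrow> bool" where
  "meager l U T \<longleftrightarrow> \<not> (\<exists>X. dense_set U T X \<and> card X \<le> 2 * l)"

definition odd_hypergraph :: "'a set \<Rightarrow> 'a set set \<Rightarrow> bool" where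
  "odd_hypergraph U T \<longleftrightarrow> (\<forall>X. X \<subseteq> U \<and> X \<noteq> {} \<longrightarrow> (\<exists>h\<in>T. odd (card (h \<inter> X))))"

end

theory Submission
  imports Defs
begin

text \<open>Oddness says that the incidence matrix of \<open>T\<close> over the two-element field has trivial kernel.
  Hyperedges are added one at a time to an empty hypergraph on many vertices, while a set \<open>I\<close> of
  vertices on which the restriction of the kernel is injective is decreased from \<open>U\<close> to \<open>{}\<close>.
  To remove \<open>v\<close> from \<open>I\<close>, at most one kernel element \<open>Z\<close> with \<open>Z \<inter> I = {v}\<close> has to be destroyed, which
  any hyperedge \<open>{v, a, b}\<close> does if \<open>a\<close>, \<open>b\<close> both lie in \<open>Z\<close> or both lie outside \<open>Z\<close>. Since there are
  at most \<open>card U\<close> hyperedges, at least half of the vertices have degree at most 5, so \<open>a\<close> and \<open>b\<close> can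
  be chosen among these, far from \<open>v\<close> and from each other. This keeps all degrees at most 7, and it
  preserves meagerness because the new hyperedge joins three different components of any small
  vertex set.\<close>

section \<open>Degrees and balls in the adjacency graph\<close>

definition degree :: "'a set set \<Rightarrow> 'a \<Rightarrow> nat" where
  "degree T x = card {h \<in> T. x \<in> h}"

definition adj :: "'a set set \<Rightarrow> ('a \<times> 'a) set" where
  "adj T = {(x, y). \<exists>h\<in>T. x \<in> h \<and> y \<in> h}"

text \<open>The ball of radius \<open>m\<close> around \<open>v\<close>. The term
  \<open>n = 0\<close> puts \<open>v\<close> into it even when no hyperedge contains
  \<open>v\<close>.\<close>

definition near :: "'a set set \<Rightarrow> nat \<Rightarrow> 'a \<Rightarrow> 'a set" where
  "near T m v = (\<Union>n\<le>m. (adj T ^^ n) `` {v})"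

lemma hypergraph_finite: "hypergraph U T \<Longrightarrow> finite T"
  unfolding hypergraph_def by (rule finite_subset[of _ "Pow U"]) auto

lemma relpow_mono_rel:
  fixes r s :: "('a \<times> 'a) set"
  shows "r \<subseteq> s \<Longrightarrow> r ^^ n \<subseteq> s ^^ n"
  by (induction n) auto

lemma self_in_near: "v \<in> near T m v"
  unfolding near_def by (auto intro!: bexI[of _ 0])

lemma sym_adj: "sym (adj T)"
  unfolding adj_def sym_def by auto

lemma card_UN_bound:
  assumes "finite A" "\<And>x. x \<in> A \<Longrightarrow> card (f x) \<le> k"
  shows "card (\<Union>x\<in>A. f x) \<le> card A * k"
  using order_trans[OF card_UN_le[OF assms(1)] sum_bounded_above[OF assms(2)]] by simp

lemma adj_Image_bound:
  assumes H: "hypergraph U T" and D: "\<And>x. x \<in> U \<Longrightarrow> degree T x \<le> d"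
  shows "finite (adj T `` {x}) \<and> card (adj T `` {x}) \<le> 3 * d"
proof -
  have eq: "adj T `` {x} = (\<Union>h\<in>{h\<in>T. x \<in> h}. h)"
    unfolding adj_def by auto
  have fin: "finite {h\<in>T. x \<in> h}"
    using hypergraph_finite[OF H] by simp
  have c3: "\<And>h. h \<in> T \<Longrightarrow> card h = 3 \<and> finite h"
    using H unfolding hypergraph_def by (meson finite_subset)
  have "card {h\<in>T. x \<in> h} \<le> d"
  proof (cases "x \<in> U")
    case True
    then show ?thesis using D[of x] by (simp add: degree_def)
  next
    case False
    then have "{h\<in>T. x \<in> h} = {}" using H unfolding hypergraph_def by blast
    then show ?thesis by (metis card.empty le0)
  qed
  moreover have "card (\<Union>h\<in>{h\<in>T. x \<in> h}. h) \<le> card {h\<in>T. x \<in> h} * 3"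
    by (rule card_UN_bound[OF fin]) (use c3 in auto)
  ultimately show ?thesis unfolding eq using fin c3 by auto
qed

text \<open>Each step multiplies the number of reached vertices by at most \<open>3 * d\<close>. The
  bound does not depend on \<open>card U\<close>, so a large \<open>U\<close> always has vertices
  outside given balls.\<close>

lemma near_bound:
  assumes H: "hypergraph U T" and D: "\<And>x. x \<in> U \<Longrightarrow> degree T x \<le> d"
  shows "finite (near T m v) \<and> card (near T m v) \<le> (\<Sum>n\<le>m. (3 * d) ^ n)"
proof -
  have step: "finite ((adj T ^^ n) `` {v}) \<and> card ((adj T ^^ n) `` {v}) \<le> (3 * d) ^ n" for n
  proof (induction n)
    case 0
    then show ?case by simp
  next
    case (Suc n)
    have eq: "(adj T ^^ Suc n) `` {v} = (\<Union>x\<in>(adj T ^^ n) `` {v}. adj T `` {x})"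
      by auto
    have "card (\<Union>x\<in>(adj T ^^ n) `` {v}. adj T `` {x}) \<le> card ((adj T ^^ n) `` {v}) * (3 * d)"
      by (rule card_UN_bound) (use Suc adj_Image_bound[OF H D] in auto)
    also have "\<dots> \<le> (3 * d) ^ Suc n" using Suc by simp
    finally show ?case unfolding eq using Suc adj_Image_bound[OF H D] by auto
  qed
  have "card (near T m v) \<le> (\<Sum>n\<le>m. card ((adj T ^^ n) `` {v}))"
    unfolding near_def by (rule card_UN_le) simp
  also have "\<dots> \<le> (\<Sum>n\<le>m. (3 * d) ^ n)" by (rule sum_mono) (use step in auto)
  finally show ?thesis using step unfolding near_def by auto
qed

section \<open>Meagerness under adding a hyperedge\<close>

lemma weight_split:
  assumes "finite T" "A \<subseteq> X" "\<And>h. h \<in> T \<Longrightarrow> h \<noteq> {}"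
    and "\<And>h. h \<in> T \<Longrightarrow> h \<subseteq> X \<Longrightarrow> h \<inter> A \<noteq> {} \<Longrightarrow> h \<subseteq> A"
  shows "weight T X = weight T A + weight T (X - A)"
proof -
  have "{h\<in>T. h \<subseteq> X} = {h\<in>T. h \<subseteq> A} \<union> {h\<in>T. h \<subseteq> X - A}"
    using assms(2,4) by blast
  moreover have "{h\<in>T. h \<subseteq> A} \<inter> {h\<in>T. h \<subseteq> X - A} = {}"
    using assms(3) by blast
  ultimately show ?thesis
    unfolding weight_def using assms(1) by (simp add: card_Un_disjoint)
qed

text \<open>A small vertex set containing the new hyperedge splits into three nonempty parts that no
  old hyperedge inside it crosses. Each part has at least one vertex more than twice its weight;
  this surplus of 3 outweighs the 2 that the new hyperedge costs.\<close>

lemma meager_insert: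
  assumes H: "hypergraph U T" and M: "meager l U T"
    and a: "a \<notin> near T ((2 * l)\<^sup>2) v"
    and b: "b \<notin> near T ((2 * l)\<^sup>2) v" "b \<notin> near T ((2 * l)\<^sup>2) a"
  shows "meager l U (insert {v, a, b} T)"
  unfolding meager_def
proof (intro notI, elim exE conjE)
  fix X assume dense: "dense_set U (insert {v, a, b} T) X" and small: "card X \<le> 2 * l"
  have XU: "X \<subseteq> U" and Xne: "X \<noteq> {}" using dense by (auto simp: dense_set_def)
  have finX: "finite X" using XU H unfolding hypergraph_def by (meson finite_subset)
  have finT: "finite T" by (rule hypergraph_finite[OF H])
  have ne: "\<And>h. h \<in> T \<Longrightarrow> h \<noteq> {}" using H unfolding hypergraph_def by fastforce
  have sparse: "2 * weight T Y + 1 \<le> card Y" if "Y \<subseteq> X" "Y \<noteq> {}" for Y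
  proof -
    have "card Y \<le> 2 * l" using card_mono[OF finX that(1)] small by linarith
    then have "\<not> card Y \<le> 2 * weight T Y"
      using M that XU unfolding meager_def dense_set_def by blast
    then show ?thesis by linarith
  qed
  have le: "card X \<le> 2 * weight (insert {v, a, b} T) X"
    using dense by (simp add: dense_set_def)
  show False
  proof (cases "{v, a, b} \<subseteq> X")
    case False
    then have "weight (insert {v, a, b} T) X = weight T X"
      unfolding weight_def by (intro arg_cong[of _ _ card]) auto
    with le sparse[OF subset_refl Xne] show False by simp
  next
    case True
    \<comment> \<open>Only hyperedges inside \<open>X\<close> count, so \<open>R\<close> has at most
      \<open>(2 * l)\<^sup>2\<close> pairs. Since \<open>R\<^sup>*\<close> needs at most
      \<open>card R\<close> steps, this gives the radius.\<close>
    define R where "R = adj {h\<in>T. h \<subseteq> X}"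
    have finR: "finite R" and cardR: "card R \<le> (2 * l)\<^sup>2"
    proof -
      have sub: "R \<subseteq> X \<times> X" unfolding R_def adj_def by auto
      then show "finite R" using finX by (meson finite_SigmaI finite_subset)
      have "card R \<le> card (X \<times> X)" using sub finX by (intro card_mono) auto
      also have "\<dots> \<le> (2 * l)\<^sup>2"
        unfolding card_cartesian_product power2_eq_square using mult_le_mono[OF small small] .
      finally show "card R \<le> (2 * l)\<^sup>2" .
    qed
    define C where "C x = R\<^sup>* `` {x}" for x
    have C_near: "C x \<subseteq> near T ((2 * l)\<^sup>2) x" for x
    proof
      fix y assume "y \<in> C x"
      then have "(x, y) \<in> R\<^sup>*" by (simp add: C_def)
      then obtain n where n: "n \<le> card R" "(x, y) \<in> R ^^ n"
        using rtrancl_finite_eq_relpow[OF finR] by auto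
      have "R \<subseteq> adj T" unfolding R_def adj_def by auto
      then have "(x, y) \<in> adj T ^^ n" using n(2) relpow_mono_rel by blast
      then show "y \<in> near T ((2 * l)\<^sup>2) x"
        unfolding near_def using n(1) cardR by (auto intro!: bexI[of _ n])
    qed
    have C_sub: "C x \<subseteq> X" if "x \<in> X" for x
    proof
      fix y assume "y \<in> C x"
      then have "(x, y) \<in> R\<^sup>*" by (simp add: C_def)
      then show "y \<in> X" using that
        by (induction rule: rtrancl_induct) (auto simp: R_def adj_def)
    qed
    have C_closed: "h \<subseteq> C x" if h: "h \<in> T" "h \<subseteq> X" "h \<inter> C x \<noteq> {}" for h x
    proof
      fix y assume "y \<in> h"
      obtain z where z: "z \<in> h" "(x, z) \<in> R\<^sup>*" using h(3) by (auto simp: C_def)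
      then have "(z, y) \<in> R" using h(1,2) \<open>y \<in> h\<close> by (auto simp: R_def adj_def)
      with z(2) show "y \<in> C x" by (auto simp: C_def)
    qed
    have C_self: "x \<in> C x" for x by (simp add: C_def)
    have va: "C v \<inter> C a = {}"
    proof (rule ccontr)
      assume "C v \<inter> C a \<noteq> {}"
      then obtain z where "(v, z) \<in> R\<^sup>*" "(a, z) \<in> R\<^sup>*" by (auto simp: C_def)
      moreover have "sym (R\<^sup>*)" unfolding R_def by (intro sym_rtrancl sym_adj)
      ultimately have "a \<in> C v" unfolding C_def by (meson Image_singleton_iff rtrancl_trans symD)
      then show False using C_near a by blast
    qed
    \<comment> \<open>The three parts are \<open>C v\<close>, \<open>C a\<close> and
      \<open>Y - C a\<close>. The last may consist of several components; it only has to contain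
      \<open>b\<close>.\<close>
    define Y where "Y = X - C v"
    have subs: "C v \<subseteq> X" "C a \<subseteq> Y" "Y \<subseteq> X" "b \<in> Y - C a"
      using C_sub C_near[of v] C_near[of a] b True va unfolding Y_def by auto
    have w1: "weight T X = weight T (C v) + weight T Y"
      unfolding Y_def by (rule weight_split) (use finT ne subs C_closed in auto)
    have w2: "weight T Y = weight T (C a) + weight T (Y - C a)"
      by (rule weight_split) (use finT ne subs C_closed in auto)
    have c1: "card X = card (C v) + card Y"
      unfolding Y_def using subs(1) finX
      by (metis Diff_partition Diff_disjoint card_Un_disjoint finite_Diff finite_subset)
    have finY: "finite Y" using finX by (simp add: Y_def)
    have c2: "card Y = card (C a) + card (Y - C a)"
      using subs(2) finY
      by (metis Diff_partition Diff_disjoint card_Un_disjoint finite_Diff finite_subset)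
    have "2 * weight T (C v) + 1 \<le> card (C v)" "2 * weight T (C a) + 1 \<le> card (C a)"
      "2 * weight T (Y - C a) + 1 \<le> card (Y - C a)"
      using C_self subs by (intro sparse; blast)+
    moreover have "weight (insert {v, a, b} T) X \<le> weight T X + 1"
    proof -
      have "{h \<in> insert {v, a, b} T. h \<subseteq> X} \<subseteq> insert {v, a, b} {h\<in>T. h \<subseteq> X}" by auto
      then have "weight (insert {v, a, b} T) X \<le> card (insert {v, a, b} {h\<in>T. h \<subseteq> X})"
        unfolding weight_def using finT by (intro card_mono) auto
      also have "\<dots> \<le> weight T X + 1"
        unfolding weight_def using finT by (simp add: card_insert_if)
      finally show ?thesis .
    qed
    ultimately show False using le w1 w2 c1 c2 by linarith
  qed
qed

section \<open>Counting vertices of low degree\<close>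

lemma sum_degree:
  assumes "hypergraph U T"
  shows "(\<Sum>x\<in>U. degree T x) = 3 * card T"
proof -
  have "\<forall>h\<in>T. card {x\<in>U. x \<in> h} = 3"
  proof
    fix h assume "h \<in> T"
    then have "{x\<in>U. x \<in> h} = h" "card h = 3" using assms unfolding hypergraph_def by auto
    then show "card {x\<in>U. x \<in> h} = 3" by simp
  qed
  then show ?thesis unfolding degree_def
    using sum_multicount[of U T "\<lambda>x h. x \<in> h" 3] assms hypergraph_finite[OF assms]
    by (simp add: hypergraph_def)
qed

text \<open>The degrees sum to at most \<open>3 * card U\<close>, so at most half of the vertices
  can have degree 6 or more.\<close>

lemma half_low_degree:
  assumes H: "hypergraph U T" and "card T \<le> card U"
  shows "card U \<le> 2 * card {x\<in>U. degree T x \<le> 5}"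
proof -
  let ?B = "{x\<in>U. \<not> degree T x \<le> 5}" and ?L = "{x\<in>U. degree T x \<le> 5}"
  have finU: "finite U" using H by (simp add: hypergraph_def)
  have "6 * card ?B = (\<Sum>x\<in>?B. 6)" by simp
  also have "\<dots> \<le> (\<Sum>x\<in>?B. degree T x)" by (rule sum_mono) auto
  also have "\<dots> \<le> (\<Sum>x\<in>U. degree T x)" by (rule sum_mono2) (use finU in auto)
  also have "\<dots> \<le> 3 * card U" using sum_degree[OF H] assms(2) by simp
  finally have "2 * card ?B \<le> card U" by simp
  moreover have "card U = card ?L + card ?B"
  proof -
    have "U = ?L \<union> ?B" by auto
    then show ?thesis using finU card_Un_disjoint[of ?L ?B] by auto
  qed
  ultimately show ?thesis by simp
qed

section \<open>The kernel over the two-element field and the stages of the construction\<close>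

lemma even_card_Int_symdiff:
  assumes "finite h" "even (card (h \<inter> A))" "even (card (h \<inter> B))"
  shows "even (card (h \<inter> (A - B \<union> (B - A))))"
proof -
  \<comment> \<open>Symmetric difference is addition mod 2: the common part
    \<open>h \<inter> A \<inter> B\<close> is counted twice and cancels.\<close>
  have "h \<inter> (A - B \<union> (B - A)) = (h \<inter> A - h \<inter> A \<inter> B) \<union> (h \<inter> B - h \<inter> A \<inter> B)" by auto
  then have "card (h \<inter> (A - B \<union> (B - A))) =
      card (h \<inter> A - h \<inter> A \<inter> B) + card (h \<inter> B - h \<inter> A \<inter> B)"
    using assms(1) by (simp add: card_Un_disjoint Int_Diff disjoint_iff)
  moreover have "card (h \<inter> A) = card (h \<inter> A - h \<inter> A \<inter> B) + card (h \<inter> A \<inter> B)"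
    using assms(1) by (subst card_Un_disjoint[symmetric]) (auto intro: arg_cong[of _ _ card])
  moreover have "card (h \<inter> B) = card (h \<inter> B - h \<inter> A \<inter> B) + card (h \<inter> A \<inter> B)"
    using assms(1) by (subst card_Un_disjoint[symmetric]) (auto intro: arg_cong[of _ _ card])
  ultimately show ?thesis using assms(2,3) by presburger
qed

definition even_kernel :: "'a set \<Rightarrow> 'a set set \<Rightarrow> 'a set set" where
  "even_kernel U T = {Z. Z \<subseteq> U \<and> (\<forall>h\<in>T. even (card (h \<inter> Z)))}"

text \<open>The set \<open>I\<close> holds the vertices still to be removed. The bounds 7 and 6 fit
  together: a removed \<open>v\<close> rises from at most 6 to at most 7, while \<open>a\<close> and
  \<open>b\<close> rise from at most 5 to at most 6 and so may stay in \<open>I\<close>. By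
  linearity the last conjunct is injectivity of restriction to \<open>I\<close>.\<close>

definition good_stage :: "nat \<Rightarrow> 'a set \<Rightarrow> 'a set set \<Rightarrow> 'a set \<Rightarrow> bool" where
  "good_stage l U T I \<longleftrightarrow> hypergraph U T \<and> meager l U T \<and> I \<subseteq> U \<and> card T + card I \<le> card U
     \<and> (\<forall>x\<in>U. degree T x \<le> 7) \<and> (\<forall>x\<in>I. degree T x \<le> 6)
     \<and> (\<forall>Z\<in>even_kernel U T. Z \<inter> I = {} \<longrightarrow> Z = {})"

lemma even_kernel_unique:
  assumes H: "hypergraph U T" and inj: "\<forall>Z\<in>even_kernel U T. Z \<inter> I = {} \<longrightarrow> Z = {}"
    and "Y \<in> even_kernel U T" "Z \<in> even_kernel U T" "Y \<inter> I = Z \<inter> I"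
  shows "Y = Z"
proof -
  have "finite h" if "h \<in> T" for h
    using H that unfolding hypergraph_def by (meson finite_subset)
  then have "Y - Z \<union> (Z - Y) \<in> even_kernel U T"
    using assms(3,4) unfolding even_kernel_def by (auto intro!: even_card_Int_symdiff)
  moreover have "(Y - Z \<union> (Z - Y)) \<inter> I = {}" using assms(5) by blast
  ultimately have "Y - Z \<union> (Z - Y) = {}" using inj by blast
  then show ?thesis by blast
qed

text \<open>The base 21 is \<open>3 * 7\<close>, from the degree bound 7. More than four times the
  ball bound many vertices have degree at most 5, so more than twice that bound lie on one side of
  \<open>Z\<close>, which two balls cannot cover.\<close>

lemma exists_far_pair:
  assumes "good_stage l U T I" and big: "8 * (\<Sum>n\<le>m. 21 ^ n) < card U"
  obtains a b where "a \<in> U" "b \<in> U" "degree T a \<le> 5" "degree T b \<le> 5" "a \<in> Z \<longleftrightarrow> b \<in> Z"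
    "a \<notin> near T m v" "b \<notin> near T m v" "b \<notin> near T m a"
proof -
  let ?M = "\<Sum>n\<le>m. 21 ^ n :: nat"
  let ?L = "{x\<in>U. degree T x \<le> 5}"
  have H: "hypergraph U T" and "card T \<le> card U" and D: "\<And>x. x \<in> U \<Longrightarrow> degree T x \<le> 7"
    using assms(1) by (auto simp: good_stage_def)
  have finL: "finite ?L" using H by (simp add: hypergraph_def)
  have near: "finite (near T m x)" "card (near T m x) \<le> ?M" for x
    using near_bound[OF H D, of m x] by simp_all
  have "card ?L = card (?L \<inter> Z) + card (?L - Z)"
    using finL card_Int_Diff by blast
  then have "2 * ?M < card (?L \<inter> Z) \<or> 2 * ?M < card (?L - Z)"
    using half_low_degree[OF H \<open>card T \<le> card U\<close>] big by linarith
  then obtain S where S: "S = ?L \<inter> Z \<or> S = ?L - Z" "2 * ?M < card S" by blast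
  have outside: "\<exists>x\<in>S. x \<notin> N" if "finite N" "card N \<le> 2 * ?M" for N
    using that S(2) card_mono[OF that(1), of S] by (meson leD order_trans subsetI)
  obtain a where a: "a \<in> S" "a \<notin> near T m v"
    using outside[OF near(1)[of v]] near(2)[of v] by auto
  obtain b where b: "b \<in> S" "b \<notin> near T m v \<union> near T m a"
    using outside[of "near T m v \<union> near T m a"] near[of v] near[of a]
      card_Un_le[of "near T m v" "near T m a"] by auto
  show thesis by (rule that[of a b]) (use a b S(1) in auto)
qed

lemma degree_insert:
  assumes "finite T"
  shows "degree (insert f T) x \<le> (if x \<in> f then Suc (degree T x) else degree T x)"
proof -
  have "{h \<in> insert f T. x \<in> h} = (if x \<in> f then insert f {h\<in>T. x \<in> h} else {h\<in>T. x \<in> h})"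
    by auto
  then show ?thesis unfolding degree_def using assms by (simp add: card_insert_if)
qed

text \<open>If no kernel element meets \<open>I\<close> exactly in \<open>v\<close>, then
  \<open>T\<close> already works for \<open>I - {v}\<close>. Otherwise the one added hyperedge is
  paid for by the loss of \<open>v\<close> from \<open>I\<close>.\<close>

lemma good_stage_step:
  assumes G: "good_stage l U T I" and v: "v \<in> I"
    and big: "8 * (\<Sum>n\<le>(2 * l)\<^sup>2. 21 ^ n) < card U"
  shows "\<exists>T'. good_stage l U T' (I - {v})"
proof (cases "\<exists>Z\<in>even_kernel U T. Z \<inter> I = {v}")
  case False
  then have "\<forall>Z\<in>even_kernel U T. Z \<inter> (I - {v}) = {} \<longrightarrow> Z \<inter> I = {}"
    by blast
  then have "good_stage l U T (I - {v})"
    using G card_Diff1_le[of I v] unfolding good_stage_def by auto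
  then show ?thesis by blast
next
  case True
  then obtain Z where Z: "Z \<in> even_kernel U T" "Z \<inter> I = {v}" by blast
  obtain a b where ab: "a \<in> U" "b \<in> U" "degree T a \<le> 5" "degree T b \<le> 5" "a \<in> Z \<longleftrightarrow> b \<in> Z"
    and far: "a \<notin> near T ((2 * l)\<^sup>2) v" "b \<notin> near T ((2 * l)\<^sup>2) v" "b \<notin> near T ((2 * l)\<^sup>2) a"
    using exists_far_pair[OF G big] by metis
  have ne: "a \<noteq> v" "b \<noteq> v" "b \<noteq> a" using far self_in_near by metis+
  let ?f = "{v, a, b}"
  have H: "hypergraph U T" and M: "meager l U T" and IU: "I \<subseteq> U"
    and cd: "card T + card I \<le> card U"
    and D7: "\<And>x. x \<in> U \<Longrightarrow> degree T x \<le> 7" and D6: "\<And>x. x \<in> I \<Longrightarrow> degree T x \<le> 6"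
    and inj: "\<forall>Z\<in>even_kernel U T. Z \<inter> I = {} \<longrightarrow> Z = {}"
    using G by (auto simp: good_stage_def)
  have finT: "finite T" by (rule hypergraph_finite[OF H])
  have finI: "finite I" using IU H unfolding hypergraph_def by (meson finite_subset)
  have H': "hypergraph U (insert ?f T)"
    using H ne v IU ab(1,2) by (auto simp: hypergraph_def)
  have cI: "card I = Suc (card (I - {v}))"
    using card_Suc_Diff1[OF finI v] by simp
  have cd': "card (insert ?f T) + card (I - {v}) \<le> card U"
    using cd cI finT card_insert_le_m1[of "Suc (card T)" T ?f] by simp
  have D7': "degree (insert ?f T) x \<le> 7" if "x \<in> U" for x
    using degree_insert[OF finT, of ?f x] D7[OF that] D6[OF v] ab(3,4)
    by (auto split: if_splits)
  have D6': "degree (insert ?f T) x \<le> 6" if "x \<in> I - {v}" for x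
    using degree_insert[OF finT, of ?f x] D6[of x] that ab(3,4)
    by (auto split: if_splits)
  \<comment> \<open>As \<open>v\<close> lies in \<open>Z\<close>, the intersection has 3 or 1
    elements.\<close>
  have odd: "odd (card (?f \<inter> Z))"
  proof (cases "a \<in> Z")
    case True
    then have "?f \<inter> Z = {v, a, b}" using Z(2) ab(5) by auto
    then show ?thesis using ne by simp
  next
    case False
    then have "?f \<inter> Z = {v}" using Z(2) ab(5) by auto
    then show ?thesis by simp
  qed
  \<comment> \<open>\<open>Y\<close> meets \<open>I\<close> at most in \<open>v\<close>. Meeting it
    in \<open>v\<close> would force \<open>Y = Z\<close>, but the new hyperedge has expelled
    \<open>Z\<close> from the kernel.\<close>
  have inj': "Y = {}" if Y: "Y \<in> even_kernel U (insert ?f T)" "Y \<inter> (I - {v}) = {}" for Y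
  proof -
    have YT: "Y \<in> even_kernel U T" using Y(1) by (auto simp: even_kernel_def)
    have "Y \<noteq> Z" using Y(1) odd by (auto simp: even_kernel_def)
    then have "Y \<inter> I \<noteq> {v}" using even_kernel_unique[OF H inj YT Z(1)] Z(2) by auto
    then have "Y \<inter> I = {}" using Y(2) by blast
    then show ?thesis using inj YT by blast
  qed
  have "good_stage l U (insert ?f T) (I - {v})"
    unfolding good_stage_def
    using H' meager_insert[OF H M far] IU cd' D7' D6' inj' by blast
  then show ?thesis by blast
qed

section \<open>Running the construction from \<open>U\<close> down to the empty set\<close>

lemma good_stage_empty:
  assumes "finite U" "U \<noteq> {}"
  shows "good_stage l U {} U"
  using assms card_0_eq[OF finite_subset[OF _ assms(1)]]
  unfolding good_stage_def hypergraph_def meager_def dense_set_def weight_def degree_def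
    even_kernel_def
  by auto

lemma good_stage_finish:
  assumes "finite I" "good_stage l U T I" "8 * (\<Sum>n\<le>(2 * l)\<^sup>2. 21 ^ n) < card U"
  shows "\<exists>T'. good_stage l U T' {}"
  using assms
proof (induction I arbitrary: T rule: finite_induct)
  case empty
  then show ?case by blast
next
  case (insert v I)
  obtain T' where "good_stage l U T' (insert v I - {v})"
    using good_stage_step[OF insert.prems(1) insertI1 insert.prems(2)] by blast
  then show ?case using insert by simp
qed

theorem theorem3p1:
  fixes l N :: nat
  assumes "l \<ge> 2" and "N > 0"
  shows "\<exists>(U :: nat set) T. hypergraph U T \<and> odd_hypergraph U T \<and> meager l U T \<and> card U > N"
proof -
  \<comment> \<open>One summand makes room for the far pairs, the other exceeds
    \<open>N\<close>.\<close>
  define n where "n = 8 * (\<Sum>n\<le>(2 * l)\<^sup>2. 21 ^ n) + N + 1"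
  let ?U = "{..<n}"
  have ne: "?U \<noteq> {}" by (auto simp: n_def)
  have big: "8 * (\<Sum>n\<le>(2 * l)\<^sup>2. 21 ^ n) < card ?U" by (simp add: n_def)
  obtain T where T: "good_stage l ?U T {}"
    using good_stage_finish[OF _ good_stage_empty[OF _ ne] big] by auto
  \<comment> \<open>For empty \<open>I\<close> every kernel element satisfies
    \<open>Z \<inter> I = {}\<close>, so the kernel is trivial, which is oddness.\<close>
  have HM: "hypergraph ?U T" "meager l ?U T" and ker: "\<forall>Z\<in>even_kernel ?U T. Z = {}"
    using T by (simp_all add: good_stage_def)
  have "odd_hypergraph ?U T"
    using ker by (auto simp: odd_hypergraph_def even_kernel_def)
  moreover have "card ?U > N" by (simp add: n_def)
  ultimately show ?thesis using HM by blast
qed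

end
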